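(* For all integers $d\ge 1$ and $n\ge 0$ we have $|\mathrm{dA}_n|\le |\mathrm{Av}_n(P_{d+3})|$.
   Context: $d$-ascent sequences. For a sequence $\alpha=a_1a_2\ldots a_n$ of nonnegative integers and $d\ge 0$, an index $k\in\{1,\dots,n-1\}$ is a $d$-ascent of $\alpha$ if $a_{k+1}>a_k-d$; $\mathrm{dasc}\,\alpha$ is the number of $d$-ascents of $\alpha$. Write $\alpha_k=a_1\ldots a_k$. The sequence $\alpha$ is a $d$-ascent sequence if $a_1=0$ and $a_{k+1}\le 1+\mathrm{dasc}\,\alpha_k$ for $k\in\{1,\dots,n-1\}$. $\mathrm{dA}_n$ is the set of $d$-ascent sequences of length $n$ (for $n=0$, just the empty sequence). Factorial posets. A poset $P$ on the set $[n]=\{1,\dots,n\}$ with strict order $<_P$ is factorial if for all $i,j,k\in[n]$: $i<j$ (as integers) and $j<_Pk$ imply $i<_Pk$. Special posets. A special $P_{d+3}$ in a poset $P$ on $[n]$ is an induced subposet consisting of a chain $i_1<_Pi_2<_P\dots<_Pi_{d+2}$ with $i_1<i_2<\dots<i_{d+2}$ as integers, together with the element $i_{d+1}+1$, where $i_{d+1}+1<i_{d+2}$ and $i_{d+1}+1$ is incomparable in $P$ to every element of the chain. $\mathrm{Av}_n(P_{d+3})$ is the set of factorial posets on $[n]$ that contain no special $P_{d+3}$ (posets are counted as labelled posets). *)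

theory Defs
  imports Main
begin

text \<open>
  The sequence \<open>a_1 ... a_n\<close> is a list \<open>xs\<close> of naturals with \<open>a_k = xs ! (k - 1)\<close>; the indices
  \<open>k\<close> below are the mathematical (1-based) ones.
  Differences are taken in the integers, as \<open>a_k - d\<close> may be negative.
\<close>

definition d_ascents :: "nat \<Rightarrow> nat list \<Rightarrow> nat set" where
  "d_ascents d xs = {k \<in> {1..<length xs}. int (xs ! k) > int (xs ! (k - 1)) - int d}"

definition dasc :: "nat \<Rightarrow> nat list \<Rightarrow> nat" where
  "dasc d xs = card (d_ascents d xs)"

definition d_ascent_seq :: "nat \<Rightarrow> nat list \<Rightarrow> bool" where
  "d_ascent_seq d xs \<longleftrightarrow>
     (xs \<noteq> [] \<longrightarrow> xs ! 0 = 0) \<and>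
     (\<forall>k\<in>{1..<length xs}. xs ! k \<le> 1 + dasc d (take k xs))"

definition dA :: "nat \<Rightarrow> nat \<Rightarrow> nat list set" where
  "dA d n = {xs. length xs = n \<and> d_ascent_seq d xs}"

text \<open>A labelled poset on \<open>{1..n}\<close> is represented by its strict order relation.\<close>

definition poset_on :: "nat \<Rightarrow> nat rel \<Rightarrow> bool" where
  "poset_on n P \<longleftrightarrow> P \<subseteq> {1..n} \<times> {1..n} \<and> irrefl P \<and> trans P"

definition factorial_poset :: "nat \<Rightarrow> nat rel \<Rightarrow> bool" where
  "factorial_poset n P \<longleftrightarrow> poset_on n P \<and>
     (\<forall>i\<in>{1..n}. \<forall>j\<in>{1..n}. \<forall>k\<in>{1..n}. i < j \<and> (j, k) \<in> P \<longrightarrow> (i, k) \<in> P)"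

definition incomparable :: "nat rel \<Rightarrow> nat \<Rightarrow> nat \<Rightarrow> bool" where
  "incomparable P x y \<longleftrightarrow> x \<noteq> y \<and> (x, y) \<notin> P \<and> (y, x) \<notin> P"

text \<open>
  The parameter is the \<open>d\<close> of \<open>P_{d+3}\<close>, so the chain \<open>c 1, ..., c (d + 2)\<close> has \<open>d + 2\<close> elements;
  only these values of \<open>c\<close> matter.
\<close>

definition has_special :: "nat \<Rightarrow> nat \<Rightarrow> nat rel \<Rightarrow> bool" where
  "has_special d n P \<longleftrightarrow> (\<exists>c :: nat \<Rightarrow> nat.
     (\<forall>k\<in>{1..d+2}. c k \<in> {1..n}) \<and>
     (\<forall>k\<in>{1..d+1}. c k < c (k + 1) \<and> (c k, c (k + 1)) \<in> P) \<and>
     c (d + 1) + 1 < c (d + 2) \<and>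
     (\<forall>k\<in>{1..d+2}. incomparable P (c (d + 1) + 1) (c k)))"

definition Av :: "nat \<Rightarrow> nat \<Rightarrow> nat rel set" where
  "Av d n = {P. factorial_poset n P \<and> \<not> has_special d n P}"

end

theory Submission
  imports Defs
begin

text \<open>
  In a factorial poset the strict down-set of \<open>k\<close> is an initial segment \<open>{1..e k}\<close> with
  \<open>e k < k\<close>, and every such function \<open>e\<close> arises. A special subposet with last chain elements
  \<open>v\<close> and \<open>q\<close> means that \<open>e q = v\<close> for some \<open>q > v + 1\<close>, while \<open>v\<close> is the top of a chain with
  \<open>d + 1\<close> elements whose bottom exceeds \<open>e (v + 1)\<close>. Thus, once \<open>e (v + 1)\<close> is known, either
  \<open>v\<close> may be used freely as a later value of \<open>e\<close>, or it is blocked for good. The avoiding posets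
  are therefore built by choosing each \<open>e k\<close> from a set \<open>allowed d e k\<close> that depends on the
  earlier choices only. It contains \<open>0\<close>, \<open>k - 1\<close> and all unblocked values in between.

  Replacing each \<open>e k\<close> by its rank in \<open>allowed d e k\<close> turns an avoiding poset into a sequence of
  naturals. The inequality holds because every \<open>d\<close>-ascent sequence is such a rank sequence.
  Indeed, a \<open>d\<close>-ascent sequence can choose its next entry among \<open>2 + dasc\<close> values, and
  there are at least as many allowed values: if \<open>v\<close> is blocked, then the rank drops by at
  least \<open>d\<close> from position \<open>v\<close> to \<open>v + 1\<close> (lemma \<open>rank_drop_if_blocked\<close>), so that \<open>v\<close> is not a
  \<open>d\<close>-ascent. The drop is that large because a value that has been used is never blocked
  afterwards: the chain that blocks \<open>v\<close> yields \<open>d - 1\<close> used, hence still allowed, values between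
  its bottom and \<open>e v\<close>, and \<open>e (v + 1)\<close> itself is one more allowed value below \<open>e v\<close>.
\<close>

definition order_of :: "(nat \<Rightarrow> nat) \<Rightarrow> nat rel" where
  "order_of e = {(i, k). 1 \<le> i \<and> i \<le> e k}"

text \<open>
  The pair \<open>(c, v)\<close> lies in the \<open>d\<close>-th relational power iff \<open>c\<close> and \<open>v\<close> are the ends of a chain
  with \<open>d + 1\<close> elements; the second condition says that \<open>v + 1\<close> is not above \<open>c\<close>.
\<close>

definition blocked :: "nat \<Rightarrow> (nat \<Rightarrow> nat) \<Rightarrow> nat \<Rightarrow> bool" where
  "blocked d e v \<longleftrightarrow> (\<exists>c. (c, v) \<in> order_of e ^^ d \<and> e (v + 1) < c)"

definition allowed :: "nat \<Rightarrow> (nat \<Rightarrow> nat) \<Rightarrow> nat \<Rightarrow> nat set" where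
  "allowed d e k = {v. v < k \<and> (v + 1 < k \<longrightarrow> \<not> blocked d e v)}"

text \<open>Values outside \<open>{1..n}\<close> are set to \<open>0\<close> so that a code is determined by its poset.\<close>

definition avoiding_codes :: "nat \<Rightarrow> nat \<Rightarrow> (nat \<Rightarrow> nat) set" where
  "avoiding_codes d n = {e. (\<forall>k\<in>{1..n}. e k \<in> allowed d e k) \<and> (\<forall>k. k \<notin> {1..n} \<longrightarrow> e k = 0)}"

definition rank :: "nat \<Rightarrow> (nat \<Rightarrow> nat) \<Rightarrow> nat \<Rightarrow> nat" where
  "rank d e k = card {v \<in> allowed d e k. v < e k}"

definition rank_seq :: "nat \<Rightarrow> nat \<Rightarrow> (nat \<Rightarrow> nat) \<Rightarrow> nat list" where
  "rank_seq d n e = map (\<lambda>k. rank d e (k + 1)) [0..<n]"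

section \<open>From codes to posets\<close>

lemma code_less: "e \<in> avoiding_codes d n \<Longrightarrow> 0 < k \<Longrightarrow> e k < k"
  by (cases "k \<le> n") (auto simp: avoiding_codes_def allowed_def)

lemma code_le: "e \<in> avoiding_codes d n \<Longrightarrow> e k \<le> k"
  using code_less[of e d n k] by (cases "k = 0") (auto simp: avoiding_codes_def)

lemma trans_order_of:
  assumes "\<And>k. e k \<le> k"
  shows "trans (order_of e)"
proof (rule transI)
  fix x y z assume "(x, y) \<in> order_of e" "(y, z) \<in> order_of e"
  then show "(x, z) \<in> order_of e"
    using assms[of y] by (auto simp: order_of_def)
qed

lemma order_of_power_imp:
  assumes "\<And>k. e k \<le> k" and "(c, v) \<in> order_of e ^^ Suc j"
  shows "(c, v) \<in> order_of e"
  using assms trans_order_of[of e] by (metis trancl_id trancl_power zero_less_Suc)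

text \<open>
  The chain below its top element \<open>q\<close> is the one that blocks \<open>v\<close>. That \<open>v\<close> is below \<open>q\<close> but
  \<open>v + 1\<close> is not pins down \<open>e q\<close>.
\<close>

lemma special_imp_blocked:
  assumes "has_special d n (order_of e)"
  obtains v q where "q \<in> {1..n}" "e q = v" "v + 1 < q" "blocked d e v"
proof -
  obtain c where
    chain: "\<forall>k\<in>{1..d+2}. c k \<in> {1..n}"
      "\<forall>k\<in>{1..d+1}. c k < c (k + 1) \<and> (c k, c (k + 1)) \<in> order_of e" and
    gap: "c (d + 1) + 1 < c (d + 2)" and
    inc: "\<forall>k\<in>{1..d+2}. incomparable (order_of e) (c (d + 1) + 1) (c k)"
    using assms unfolding has_special_def by blast
  have "(c 1, c (d + 1)) \<in> order_of e ^^ d"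
    unfolding relpow_fun_conv using chain(2)
    by (intro exI[of _ "\<lambda>i. c (i + 1)"]) auto
  moreover have "e (c (d + 1) + 1) < c 1"
    using inc chain(1) by (force simp: incomparable_def order_of_def)
  ultimately have "blocked d e (c (d + 1))"
    unfolding blocked_def by blast
  moreover have "e (c (d + 2)) = c (d + 1)"
  proof -
    have "c (d + 1) \<le> e (c (d + 2))"
      using chain(2)[rule_format, of "d + 1"] by (auto simp: order_of_def)
    moreover have "(c (d + 1) + 1, c (d + 2)) \<notin> order_of e"
      using inc by (auto simp: incomparable_def)
    ultimately show ?thesis by (auto simp: order_of_def)
  qed
  ultimately show thesis
    using that[of "c (d + 2)" "c (d + 1)"] chain(1) gap by auto
qed

lemma order_of_in_Av:
  assumes e: "e \<in> avoiding_codes d n"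
  shows "order_of e \<in> Av d n"
proof -
  have pairs: "i \<in> {1..n} \<and> k \<in> {1..n} \<and> i < k" if "(i, k) \<in> order_of e" for i k
  proof -
    have "1 \<le> i" "i \<le> e k" using that by (auto simp: order_of_def)
    moreover from this have "k \<in> {1..n}"
      using e unfolding avoiding_codes_def by (metis (mono_tags, lifting) mem_Collect_eq not_one_le_zero le_zero_eq)
    ultimately show ?thesis using code_less[OF e, of k] by auto
  qed
  have "poset_on n (order_of e)"
    using pairs trans_order_of code_le[OF e] by (force simp: poset_on_def irrefl_def)
  then have "factorial_poset n (order_of e)"
    by (auto simp: factorial_poset_def order_of_def)
  moreover have "\<not> has_special d n (order_of e)"
  proof
    assume "has_special d n (order_of e)"
    then obtain v q where "q \<in> {1..n}" "e q = v" "v + 1 < q" "blocked d e v"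
      by (rule special_imp_blocked)
    then show False using e by (auto simp: avoiding_codes_def allowed_def)
  qed
  ultimately show ?thesis by (simp add: Av_def)
qed

lemma inj_order_of: "inj order_of"
proof (rule injI, rule ext)
  fix e f :: "nat \<Rightarrow> nat" and k assume "order_of e = order_of f"
  then have "{i. 1 \<le> i \<and> i \<le> e k} = {i. 1 \<le> i \<and> i \<le> f k}"
    by (auto simp: order_of_def set_eq_iff)
  then have "{1..e k} = {1..f k}" by (auto simp: set_eq_iff)
  then show "e k = f k" by (metis card_atLeastAtMost diff_Suc_1)
qed

lemma finite_Av: "finite (Av d n)"
  by (rule finite_subset[of _ "Pow ({1..n} \<times> {1..n})"])
    (auto simp: Av_def factorial_poset_def poset_on_def)

section \<open>Blocked values and the drop of the rank\<close>

lemma finite_allowed [simp]: "finite (allowed d e k)"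
  by (rule finite_subset[of _ "{..<k}"]) (auto simp: allowed_def)

text \<open>
  A value chosen at \<open>m\<close> was either already known to be unblocked, or it is \<open>m - 1\<close>. In the latter
  case every chain below \<open>m - 1\<close> also lies below \<open>m\<close>, so the choice of
  \<open>m - 1\<close> at \<open>m\<close> prevents it from being blocked.
\<close>

lemma used_value_not_blocked:
  assumes e: "e \<in> avoiding_codes d n" and "d \<ge> 1" and m: "m \<in> {1..n}"
  shows "\<not> blocked d e (e m)"
proof
  assume b: "blocked d e (e m)"
  have "e m \<in> allowed d e m" using e m by (auto simp: avoiding_codes_def)
  with b have last: "e m + 1 = m" by (auto simp: allowed_def)
  obtain c where c: "(c, e m) \<in> order_of e ^^ d" "e (e m + 1) < c"
    using b by (auto simp: blocked_def)
  obtain j where "d = Suc j" using \<open>d \<ge> 1\<close> by (cases d) auto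
  with c(1) have "(c, e m) \<in> order_of e"
    using order_of_power_imp code_le[OF e] by blast
  then have "c \<le> e m" using code_le[OF e, of "e m"] by (auto simp: order_of_def)
  with c(2) last show False by simp
qed

text \<open>
  Each intermediate element \<open>m\<close> of a chain contributes the used value \<open>e m\<close>, and these values
  are distinct since \<open>e m < m \<le> e m'\<close> when \<open>m'\<close> comes next.
\<close>

lemma chain_gives_allowed_values:
  assumes e: "e \<in> avoiding_codes d n" and d: "d \<ge> 1"
    and "(c, p) \<in> order_of e ^^ Suc j"
  shows "j \<le> card {v \<in> allowed d e p. c \<le> v \<and> v < e p}"
  using assms(3)
proof (induction j arbitrary: p)
  case 0
  then show ?case by simp
next
  case (Suc j)
  let ?R = "\<lambda>p. {v \<in> allowed d e p. c \<le> v \<and> v < e p}"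
  obtain m where m: "(c, m) \<in> order_of e ^^ Suc j" "(m, p) \<in> order_of e"
    using Suc.prems by (meson relpow_Suc_E)
  have cm: "c \<le> e m" "1 \<le> c"
    using order_of_power_imp[OF _ m(1)] code_le[OF e] by (auto simp: order_of_def)
  have mp: "1 \<le> m" "m \<le> e p" using m(2) by (auto simp: order_of_def)
  have mn: "m \<in> {1..n}"
    using cm e unfolding avoiding_codes_def
    by (metis (mono_tags, lifting) mem_Collect_eq not_one_le_zero le_zero_eq)
  have lt: "e m < m" "e p < p"
    using code_less[OF e] mp code_le[OF e, of p] by auto
  have "insert (e m) (?R m) \<subseteq> ?R p"
    using used_value_not_blocked[OF e d mn] cm mp lt by (auto simp: allowed_def)
  then have "card (insert (e m) (?R m)) \<le> card (?R p)"
    by (intro card_mono) auto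
  moreover have "j \<le> card (?R m)" using Suc.IH m(1) by simp
  ultimately show ?case by simp
qed

lemma rank_drop_if_blocked:
  assumes e: "e \<in> avoiding_codes d n" and d: "d \<ge> 1"
    and p: "p + 1 \<le> n" and b: "blocked d e p"
  shows "rank d e (p + 1) + d \<le> rank d e p"
proof -
  obtain j where j: "d = Suc j" using d by (cases d) auto
  obtain c where c: "(c, p) \<in> order_of e ^^ Suc j" "e (p + 1) < c"
    using b j by (auto simp: blocked_def)
  have cp: "1 \<le> c" "c \<le> e p"
    using order_of_power_imp[OF _ c(1)] code_le[OF e] by (auto simp: order_of_def)
  then have lt: "e p < p" using code_less[OF e, of p] code_le[OF e, of p] by auto
  let ?low = "{v \<in> allowed d e (p + 1). v < e (p + 1)}"
  let ?mid = "{v \<in> allowed d e p. c \<le> v \<and> v < e p}"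
  have "e (p + 1) \<in> allowed d e (p + 1)"
    using e p by (auto simp: avoiding_codes_def)
  then have "insert (e (p + 1)) ?low \<union> ?mid \<subseteq> {v \<in> allowed d e p. v < e p}"
    using c(2) cp lt by (auto simp: allowed_def)
  then have "card (insert (e (p + 1)) ?low \<union> ?mid) \<le> rank d e p"
    unfolding rank_def by (intro card_mono) auto
  moreover have "card (insert (e (p + 1)) ?low \<union> ?mid) = Suc (card ?low) + card ?mid"
    using c(2) by (subst card_Un_disjoint) auto
  moreover have "j \<le> card ?mid"
    by (rule chain_gives_allowed_values[OF e d c(1)])
  ultimately show ?thesis using j by (simp add: rank_def)
qed

lemma rank_seq_nth: "i < n \<Longrightarrow> rank_seq d n e ! i = rank d e (i + 1)"
  by (simp add: rank_seq_def)

lemma d_ascents_subset_allowed: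
  assumes e: "e \<in> avoiding_codes d n" and d: "d \<ge> 1"
  shows "d_ascents d (rank_seq d n e) \<subseteq> allowed d e (n + 1)"
proof
  fix p assume "p \<in> d_ascents d (rank_seq d n e)"
  then have p: "1 \<le> p" "p < n"
    and asc: "int (rank_seq d n e ! p) > int (rank_seq d n e ! (p - 1)) - int d"
    by (auto simp: d_ascents_def rank_seq_def)
  have "\<not> rank d e (p + 1) + d \<le> rank d e p"
    using asc p by (simp add: rank_seq_nth)
  then have "\<not> blocked d e p"
    using rank_drop_if_blocked[OF e d, of p] p by auto
  then show "p \<in> allowed d e (n + 1)" using p by (simp add: allowed_def)
qed

text \<open>Besides the \<open>d\<close>-ascents, the values \<open>0\<close> and \<open>n\<close> are allowed at position \<open>n + 1\<close>.\<close>

lemma dasc_bound_allowed: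
  assumes e: "e \<in> avoiding_codes d n" and d: "d \<ge> 1" and n: "n \<ge> 1"
  shows "2 + dasc d (rank_seq d n e) \<le> card (allowed d e (n + 1))"
proof -
  let ?D = "d_ascents d (rank_seq d n e)"
  have D: "?D \<subseteq> {1..<n}" by (auto simp: d_ascents_def rank_seq_def)
  then have fin: "finite ?D" by (rule finite_subset) simp
  have "\<not> blocked d e 0"
  proof
    assume "blocked d e 0"
    then obtain c where c: "(c, 0) \<in> order_of e ^^ d" "e 1 < c"
      by (auto simp: blocked_def)
    obtain j where "d = Suc j" using d by (cases d) auto
    with c have "(c, 0) \<in> order_of e" using order_of_power_imp code_le[OF e] by blast
    then show False using code_le[OF e, of 0] by (simp add: order_of_def)
  qed
  then have "insert 0 (insert n ?D) \<subseteq> allowed d e (n + 1)"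
    using d_ascents_subset_allowed[OF e d] by (simp add: allowed_def)
  then have "card (insert 0 (insert n ?D)) \<le> card (allowed d e (n + 1))"
    by (intro card_mono) auto
  moreover have "0 \<notin> insert n ?D" "n \<notin> ?D" using D n by auto
  ultimately show ?thesis using fin by (simp add: dasc_def)
qed

section \<open>Every \<open>d\<close>-ascent sequence is a rank sequence\<close>

lemma ex_element_of_rank:
  fixes A :: "nat set"
  assumes "finite A" and "a < card A"
  shows "\<exists>v\<in>A. card {x \<in> A. x < v} = a"
  using assms
proof (induction A rule: finite_linorder_max_induct)
  case empty
  then show ?case by simp
next
  case (insert b A)
  show ?case
  proof (cases "a = card A")
    case True
    have "{x \<in> insert b A. x < b} = A" using insert.hyps by auto
    then show ?thesis using True by auto
  next
    case False
    have "b \<notin> A" using insert.hyps by auto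
    then have "a < card A" using False insert.prems insert.hyps by simp
    then obtain v where v: "v \<in> A" "card {x \<in> A. x < v} = a" using insert.IH by auto
    then have "{x \<in> insert b A. x < v} = {x \<in> A. x < v}" using insert.hyps by auto
    then show ?thesis using v by (intro bexI[of _ v]) simp_all
  qed
qed

text \<open>
  Chains descend, so those ending below \<open>k\<close> only see the code below \<open>k\<close>. Hence the values
  allowed at \<open>k\<close> depend only on the earlier choices, and codes can be built step by step.
\<close>

lemma order_of_power_cong:
  assumes "\<And>i. i < k \<Longrightarrow> e i = f i" and "\<And>i. e i \<le> i" and "v < k"
  shows "(c, v) \<in> order_of e ^^ j \<longleftrightarrow> (c, v) \<in> order_of f ^^ j"
  using \<open>v < k\<close>
proof (induction j arbitrary: v)
  case 0
  then show ?case by simp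
next
  case (Suc j)
  have step: "(m, v) \<in> order_of e \<longleftrightarrow> (m, v) \<in> order_of f" for m
    using assms(1)[OF Suc.prems] by (simp add: order_of_def)
  have "(c, m) \<in> order_of e ^^ j \<longleftrightarrow> (c, m) \<in> order_of f ^^ j" if "(m, v) \<in> order_of e" for m
    using that Suc.IH[of m] assms(2)[of v] Suc.prems by (simp add: order_of_def)
  then show ?case using step by auto
qed

lemma allowed_cong:
  assumes "\<And>i. i < k \<Longrightarrow> e i = f i" and "\<And>i. e i \<le> i"
  shows "allowed d e k = allowed d f k"
proof -
  have "blocked d e v \<longleftrightarrow> blocked d f v" if "v + 1 < k" for v
    using that assms(1)[of "v + 1"] order_of_power_cong[OF assms, of k v] assms
    by (simp add: blocked_def)
  then show ?thesis by (auto simp: allowed_def)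
qed

lemma extend_code:
  assumes e: "e \<in> avoiding_codes d n" and v: "v \<in> allowed d e (n + 1)"
  shows "e(n + 1 := v) \<in> avoiding_codes d (n + 1)"
    and "rank_seq d (n + 1) (e(n + 1 := v)) =
      rank_seq d n e @ [card {x \<in> allowed d e (n + 1). x < v}]"
proof -
  let ?f = "e(n + 1 := v)"
  have A: "allowed d ?f k = allowed d e k" if "k \<le> n + 1" for k
    by (rule allowed_cong[symmetric]) (use that code_le[OF e] in auto)
  show "?f \<in> avoiding_codes d (n + 1)"
    using e v A by (auto simp: avoiding_codes_def)
  have "rank d ?f k = rank d e k" if "k \<le> n" for k
    using that A by (simp add: rank_def)
  moreover have "rank d ?f (n + 1) = card {x \<in> allowed d e (n + 1). x < v}"
    using A by (simp add: rank_def)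
  ultimately show "rank_seq d (n + 1) ?f =
      rank_seq d n e @ [card {x \<in> allowed d e (n + 1). x < v}]"
    by (simp add: rank_seq_def)
qed

lemma d_ascent_seq_snocD:
  assumes "d_ascent_seq d (xs @ [a])"
  shows "d_ascent_seq d xs" and "xs = [] \<Longrightarrow> a = 0"
    and "xs \<noteq> [] \<Longrightarrow> a \<le> 1 + dasc d xs"
proof -
  have bound: "(xs @ [a]) ! k \<le> 1 + dasc d (take k (xs @ [a]))" if "k \<in> {1..length xs}" for k
    using assms that by (simp add: d_ascent_seq_def)
  have "xs ! k \<le> 1 + dasc d (take k xs)" if "k \<in> {1..<length xs}" for k
    using bound[of k] that by (simp add: nth_append)
  moreover have "xs \<noteq> [] \<Longrightarrow> xs ! 0 = 0"
    using assms by (auto simp: d_ascent_seq_def nth_append)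
  ultimately show "d_ascent_seq d xs" by (simp add: d_ascent_seq_def)
  show "xs = [] \<Longrightarrow> a = 0" using assms by (simp add: d_ascent_seq_def)
  show "xs \<noteq> [] \<Longrightarrow> a \<le> 1 + dasc d xs"
    using bound[of "length xs"] by (simp add: Suc_le_eq)
qed

lemma d_ascent_seq_is_rank_seq:
  assumes d: "d \<ge> 1" and "d_ascent_seq d xs"
  shows "\<exists>e \<in> avoiding_codes d (length xs). rank_seq d (length xs) e = xs"
  using assms(2)
proof (induction xs rule: rev_induct)
  case Nil
  have "(\<lambda>k. 0) \<in> avoiding_codes d 0" by (simp add: avoiding_codes_def)
  then show ?case by (auto simp: rank_seq_def)
next
  case (snoc a xs)
  let ?n = "length xs"
  note xs = d_ascent_seq_snocD[OF snoc.prems]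
  obtain e where e: "e \<in> avoiding_codes d ?n" "rank_seq d ?n e = xs"
    using snoc.IH xs(1) by blast
  have "a < card (allowed d e (?n + 1))"
  proof (cases "xs = []")
    case True
    have "allowed d e 1 = {0}" by (auto simp: allowed_def)
    then show ?thesis using True xs(2) by simp
  next
    case False
    then show ?thesis using dasc_bound_allowed[OF e(1) d] xs(3) e(2)
      by (simp add: Suc_le_eq)
  qed
  then obtain v where v: "v \<in> allowed d e (?n + 1)"
      "card {x \<in> allowed d e (?n + 1). x < v} = a"
    using ex_element_of_rank[OF finite_allowed] by blast
  show ?case
    using extend_code[OF e(1) v(1)] v(2) e(2) by auto
qed

theorem theorem5p1:
  fixes d n :: nat
  assumes "d \<ge> 1"
  shows "card (dA d n) \<le> card (Av d n)"
proof -
  have into: "order_of ` avoiding_codes d n \<subseteq> Av d n"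
    using order_of_in_Av by blast
  have inj: "inj_on order_of (avoiding_codes d n)"
    using inj_order_of by (rule inj_on_subset) simp
  have "dA d n \<subseteq> rank_seq d n ` avoiding_codes d n"
    using d_ascent_seq_is_rank_seq[OF assms] by (force simp: dA_def)
  then have "card (dA d n) \<le> card (avoiding_codes d n)"
    by (rule surj_card_le[OF inj_on_finite[OF inj into finite_Av]])
  also have "\<dots> \<le> card (Av d n)"
    by (rule card_inj_on_le[OF inj into finite_Av])
  finally show ?thesis .
qed

end
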